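(* For every $\epsilon \geq 1$ and every positive integer $n$, the algorithm $\mathrm{DPAnonHist}_{\epsilon,n}$ described in the context is $\epsilon$-differentially private (with respect to neighboring integer partitions in $\mathcal{I}_{\leq n}$), and its error for integer partitions of size at most $n$ is $O(\sqrt{n}/e^{\epsilon})$; that is, there is an absolute constant $C>0$ such that for all $\epsilon \ge 1$, all $n \ge 1$ and all $\mathbf{p} \in \mathcal{I}_{\leq n}$, $\mathbb{E}[\|\mathrm{DPAnonHist}_{\epsilon,n}(\mathbf{p}) - \mathbf{p}\|_1] \leq C\sqrt{n}/e^{\epsilon}$.
   Context: An integer partition is an infinite sequence $\mathbf{p}=(p_1,p_2,\dots)$ of non-negative integers with $p_1 \ge p_2 \ge \cdots$ and finite size $\sum_i p_i$. $\mathcal{I}_{\leq n}$ denotes the set of integer partitions of size at most $n$. Distances between sequences (possibly of different finite lengths, padded with zeros) are $\ell_1$ distances $\|\mathbf{v}-\mathbf{v}'\|_1=\sum_i |v_i - v'_i|$. Two integer partitions $\mathbf{p},\mathbf{p}'$ are neighbors iff $\|\mathbf{p}-\mathbf{p}'\|_1 \le 1$. A randomized algorithm $\mathcal{A}$ is $(\epsilon,\delta)$-DP if for every pair of neighboring inputs $\mathbf{p},\mathbf{p}'$ and every set $S$ of outputs, $\Pr[\mathcal{A}(\mathbf{p})\in S] \le e^{\epsilon}\Pr[\mathcal{A}(\mathbf{p}')\in S]+\delta$; $\epsilon$-DP means $(\epsilon,0)$-DP. The error of $\mathcal{A}$ for integer partitions of size at most $n$ is $\max_{\mathbf{p}\in\mathcal{I}_{\le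 n}} \mathbb{E}[\|\mathcal{A}(\mathbf{p})-\mathbf{p}\|_1]$. For an integer partition $\mathbf{p}$ and $r \in \mathbb{N}$, the cumulative prevalence is $\phi_{\ge r}(\mathbf{p}) = |\{i : p_i \ge r\}|$, and $\boldsymbol{\phi}_{\ge}(\mathbf{p}) = (\phi_{\ge 1}(\mathbf{p}),\phi_{\ge 2}(\mathbf{p}),\dots)$; for a vector $\mathbf{v}$ indexed by $\mathbb{N}$, $\mathbf{v}_{[m]}=(v_1,\dots,v_m)$. The union $\mathbf{p}^1\cup\mathbf{p}^2$ of two integer partitions is the integer partition whose $i$-th entry is the $i$-th largest element of the multiset union $\{p^1_i\}\cup\{p^2_i\}$. The two-sided geometric distribution $\mathrm{Geo}(\alpha)$, $0<\alpha<1$, assigns probability $\alpha^{|i|}\frac{1-\alpha}{1+\alpha}$ to each integer $i$; $\mathrm{Geo}(\alpha)^{\otimes m}$ is a vector of $m$ independent samples. Algorithm $\mathrm{DPAnonHist}_{\epsilon,n}(\mathbf{p})$ (input $\mathbf{p}\in\mathcal{I}_{\le n}$, parameters $\epsilon\ge 1$, $n\in\mathbb{N}$): (1) $m \leftarrow \lceil \sqrt{n}\rceil$; (2) $\mathbf{p}^{high,noised} = (p_1,\dots,p_m) + \mathrm{Geo}(e^{-\epsilon})^{\otimes m}$; (3) $\boldsymbol{\phi}^{low,noised} = \boldsymbol{\phi}_{\ge}((p_{m+1},p_{m+2},\dots))_{[m]} + \mathrm{Geo}(e^{-\epsilon})^{\otimes m}$ (independent noise); (4) $\mathbf{p}^{high,priv}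 \in \arg\min_{\mathbf{q}\in\mathcal{I}_{\le n}} \|\mathbf{p}^{high,noised}-\mathbf{q}\|_1$; (5) $\mathbf{p}^{low,priv} \in \arg\min_{\mathbf{q}\in\mathcal{I}_{\le n}}\|\boldsymbol{\phi}^{low,noised}-\boldsymbol{\phi}_{\ge}(\mathbf{q})\|_1$; (6) output $\mathbf{p}^{high,priv}\cup\mathbf{p}^{low,priv}$. *)

theory Defs
  imports "HOL-Probability.Probability"
begin

text \<open>
  Sequences are indexed from 0, so the entry \<open>p\<^sub>i\<close> of a sequence is \<open>p (i - 1)\<close> here.
  A vector of finite length is represented by the sequence that pads it with zeros.
\<close>

definition integer_partition :: "(nat \<Rightarrow> nat) \<Rightarrow> bool" where
  "integer_partition p \<longleftrightarrow> antimono p \<and> summable p"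

definition partitions_upto :: "nat \<Rightarrow> (nat \<Rightarrow> nat) set" where
  "partitions_upto n = {p. integer_partition p \<and> (\<Sum>i. p i) \<le> n}"

definition l1_dist :: "(nat \<Rightarrow> int) \<Rightarrow> (nat \<Rightarrow> int) \<Rightarrow> ennreal" where
  "l1_dist v w = (\<Sum>i. ennreal (real_of_int \<bar>v i - w i\<bar>))"

definition neighbors :: "(nat \<Rightarrow> nat) \<Rightarrow> (nat \<Rightarrow> nat) \<Rightarrow> bool" where
  "neighbors p p' \<longleftrightarrow>
     integer_partition p \<and> integer_partition p' \<and> l1_dist (int \<circ> p) (int \<circ> p') \<le> 1"

definition differentially_private ::
    "real \<Rightarrow> real \<Rightarrow> (nat \<Rightarrow> nat) set \<Rightarrow> ((nat \<Rightarrow> nat) \<Rightarrow> 'b pmf) \<Rightarrow> bool" where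
  "differentially_private \<epsilon> \<delta> X \<A> \<longleftrightarrow>
     (\<forall>p\<in>X. \<forall>p'\<in>X. neighbors p p' \<longrightarrow>
        (\<forall>S. measure_pmf.prob (\<A> p) S \<le> exp \<epsilon> * measure_pmf.prob (\<A> p') S + \<delta>))"

text \<open>
  The expectation is a nonnegative integral, so a bound on it also says that it is finite.
  The supremum is a maximum by \<open>finite_partitions_upto\<close> below.
\<close>

definition error_upto :: "nat \<Rightarrow> ((nat \<Rightarrow> nat) \<Rightarrow> (nat \<Rightarrow> nat) pmf) \<Rightarrow> ennreal" where
  "error_upto n \<A> =
     (SUP p\<in>partitions_upto n. \<integral>\<^sup>+q. l1_dist (int \<circ> q) (int \<circ> p) \<partial>measure_pmf (\<A> p))"

definition cumulative_prevalence :: "nat \<Rightarrow> (nat \<Rightarrow> nat) \<Rightarrow> nat" where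
  "cumulative_prevalence r p = card {i. p i \<ge> r}"

definition cumulative_prevalences :: "(nat \<Rightarrow> nat) \<Rightarrow> nat \<Rightarrow> nat" where
  "cumulative_prevalences p = (\<lambda>i. cumulative_prevalence (i + 1) p)"

definition truncate_seq :: "nat \<Rightarrow> (nat \<Rightarrow> nat) \<Rightarrow> nat \<Rightarrow> nat" where
  "truncate_seq m v = (\<lambda>i. if i < m then v i else 0)"

text \<open>
  The infinitely many zero entries are left out of the multiset and restored by the padding.
\<close>

definition positive_parts :: "(nat \<Rightarrow> nat) \<Rightarrow> nat multiset" where
  "positive_parts p = image_mset p (mset_set {i. p i > 0})"

definition partition_union :: "(nat \<Rightarrow> nat) \<Rightarrow> (nat \<Rightarrow> nat) \<Rightarrow> nat \<Rightarrow> nat" where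
  "partition_union p q =
     (let xs = rev (sorted_list_of_multiset (positive_parts p + positive_parts q))
      in (\<lambda>i. if i < length xs then xs ! i else 0))"

definition two_sided_geometric_pmf :: "real \<Rightarrow> int pmf" where
  "two_sided_geometric_pmf \<alpha> = embed_pmf (\<lambda>i. \<alpha> ^ nat \<bar>i\<bar> * ((1 - \<alpha>) / (1 + \<alpha>)))"

definition geometric_noise :: "real \<Rightarrow> nat \<Rightarrow> (nat \<Rightarrow> int) pmf" where
  "geometric_noise \<alpha> m = Pi_pmf {..<m} 0 (\<lambda>_. two_sided_geometric_pmf \<alpha>)"

definition high_minimizers :: "nat \<Rightarrow> (nat \<Rightarrow> int) \<Rightarrow> (nat \<Rightarrow> nat) set" where
  "high_minimizers n v =
     {q. is_arg_min (\<lambda>q. l1_dist v (int \<circ> q)) (\<lambda>q. q \<in> partitions_upto n) q}"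

definition low_minimizers :: "nat \<Rightarrow> (nat \<Rightarrow> int) \<Rightarrow> (nat \<Rightarrow> nat) set" where
  "low_minimizers n v =
     {q. is_arg_min (\<lambda>q. l1_dist v (int \<circ> cumulative_prevalences q))
           (\<lambda>q. q \<in> partitions_upto n) q}"

text \<open>
  The algorithm may return any minimizer. The tie-breaking rules \<open>H\<close> and \<open>L\<close> are parameters that
  see only the noised vectors. They may be randomized; a deterministic rule returns \<open>return_pmf\<close>
  of its choice.
\<close>

definition dp_anon_hist ::
    "((nat \<Rightarrow> int) \<Rightarrow> (nat \<Rightarrow> nat) pmf) \<Rightarrow> ((nat \<Rightarrow> int) \<Rightarrow> (nat \<Rightarrow> nat) pmf) \<Rightarrow>
     real \<Rightarrow> nat \<Rightarrow> (nat \<Rightarrow> nat) \<Rightarrow> (nat \<Rightarrow> nat) pmf" where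
  "dp_anon_hist H L \<epsilon> n p =
     (let m = nat \<lceil>sqrt (real n)\<rceil>;
          p_high = truncate_seq m p;
          phi_low = truncate_seq m (cumulative_prevalences (\<lambda>i. p (m + i)))
      in do {
        x \<leftarrow> geometric_noise (exp (- \<epsilon>)) m;
        y \<leftarrow> geometric_noise (exp (- \<epsilon>)) m;
        high_priv \<leftarrow> H (\<lambda>i. int (p_high i) + x i);
        low_priv \<leftarrow> L (\<lambda>i. int (phi_low i) + y i);
        return_pmf (partition_union high_priv low_priv)
      })"

lemma pmf_two_sided_geometric:
  assumes "0 < \<alpha>" "\<alpha> < 1"
  shows "pmf (two_sided_geometric_pmf \<alpha>) i = \<alpha> ^ nat \<bar>i\<bar> * ((1 - \<alpha>) / (1 + \<alpha>))"
proof -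
  let ?c = "(1 - \<alpha>) / (1 + \<alpha>)"
  let ?f = "\<lambda>i::int. \<alpha> ^ nat \<bar>i\<bar> * ?c"
  have c: "?c \<ge> 0" using assms by simp
  have split: "(UNIV :: int set) = range int \<union> range (\<lambda>k. - int (Suc k))"
    using int_cases by blast
  have s0: "(\<lambda>k. \<alpha> ^ k * ?c) sums (1 / (1 - \<alpha>) * ?c)"
    using assms by (intro sums_mult2 geometric_sums) auto
  have s1: "(\<lambda>k. \<alpha> * (\<alpha> ^ k * ?c)) sums (\<alpha> * (1 / (1 - \<alpha>) * ?c))"
    by (intro sums_mult s0)
  have n0: "(\<integral>\<^sup>+i. ennreal (?f i) \<partial>count_space (range int)) = ennreal (1 / (1 - \<alpha>) * ?c)"
  proof -
    have "(\<integral>\<^sup>+i. ennreal (?f i) \<partial>count_space (range int)) =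
          (\<integral>\<^sup>+k. ennreal (?f (int k)) \<partial>count_space UNIV)"
      by (intro nn_integral_bij_count_space[symmetric] inj_on_imp_bij_betw) (auto simp: inj_on_def)
    also have "\<dots> = (\<Sum>k. ennreal (\<alpha> ^ k * ?c))"
      by (simp add: nn_integral_count_space_nat)
    also have "\<dots> = ennreal (1 / (1 - \<alpha>) * ?c)"
      using assms c s0 by (intro suminf_ennreal_eq) auto
    finally show ?thesis .
  qed
  have n1: "(\<integral>\<^sup>+i. ennreal (?f i) \<partial>count_space (range (\<lambda>k. - int (Suc k)))) =
            ennreal (\<alpha> * (1 / (1 - \<alpha>) * ?c))"
  proof -
    have "(\<integral>\<^sup>+i. ennreal (?f i) \<partial>count_space (range (\<lambda>k. - int (Suc k)))) =
          (\<integral>\<^sup>+k. ennreal (?f (- int (Suc k))) \<partial>count_space UNIV)"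
      by (intro nn_integral_bij_count_space[symmetric] inj_on_imp_bij_betw) (auto simp: inj_on_def)
    also have "\<dots> = (\<integral>\<^sup>+k. ennreal (\<alpha> * (\<alpha> ^ k * ?c)) \<partial>count_space UNIV)"
    proof (intro nn_integral_cong arg_cong[where f = ennreal])
      fix k :: nat
      have "nat \<bar>- int (Suc k)\<bar> = Suc k" by simp
      then show "?f (- int (Suc k)) = \<alpha> * (\<alpha> ^ k * ?c)"
        by (simp only: power_Suc mult.assoc)
    qed
    also have "\<dots> = (\<Sum>k. ennreal (\<alpha> * (\<alpha> ^ k * ?c)))"
      by (simp add: nn_integral_count_space_nat)
    also have "\<dots> = ennreal (\<alpha> * (1 / (1 - \<alpha>) * ?c))"
      using assms c s1 by (intro suminf_ennreal_eq) auto
    finally show ?thesis .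
  qed
  have "(\<integral>\<^sup>+i. ennreal (?f i) \<partial>count_space UNIV) =
        (\<integral>\<^sup>+i. ennreal (?f i) * indicator (range int) i +
              ennreal (?f i) * indicator (range (\<lambda>k. - int (Suc k))) i \<partial>count_space UNIV)"
  proof (intro nn_integral_cong)
    fix i :: int
    have "i \<in> range int \<longleftrightarrow> i \<notin> range (\<lambda>k. - int (Suc k))"
      using split by (cases i rule: int_cases) auto
    then show "ennreal (?f i) = ennreal (?f i) * indicator (range int) i +
              ennreal (?f i) * indicator (range (\<lambda>k. - int (Suc k))) i"
      by (auto simp: indicator_def)
  qed
  also have "\<dots> = (\<integral>\<^sup>+i. ennreal (?f i) \<partial>count_space (range int)) +
                  (\<integral>\<^sup>+i. ennreal (?f i) \<partial>count_space (range (\<lambda>k. - int (Suc k))))"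
    by (subst nn_integral_add) (auto simp: nn_integral_count_space_indicator)
  also have "\<dots> = ennreal (1 / (1 - \<alpha>) * ?c + \<alpha> * (1 / (1 - \<alpha>) * ?c))"
    unfolding n0 n1 using assms c by (intro ennreal_plus[symmetric]) auto
  also have "1 / (1 - \<alpha>) * ?c + \<alpha> * (1 / (1 - \<alpha>) * ?c) = 1"
    using assms by (simp add: divide_simps)
  finally have "(\<integral>\<^sup>+i. ennreal (?f i) \<partial>count_space UNIV) = 1" by simp
  then show ?thesis
    unfolding two_sided_geometric_pmf_def using assms c by (intro pmf_embed_pmf) auto
qed

lemma finite_partitions_upto: "finite (partitions_upto n)"
proof (rule finite_subset)
  show "partitions_upto n \<subseteq> {p. \<forall>i. (i \<in> {..<n} \<longrightarrow> p i \<in> {..n}) \<and> (i \<notin> {..<n} \<longrightarrow> p i = 0)}"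
  proof (intro subsetI CollectI allI)
    fix p i assume "p \<in> partitions_upto n"
    then have p: "antimono p" "summable p" "(\<Sum>i. p i) \<le> n"
      by (auto simp: partitions_upto_def integer_partition_def)
    have "Suc i * p i = (\<Sum>j<Suc i. p i)" by simp
    also have "\<dots> \<le> (\<Sum>j<Suc i. p j)"
      using p(1) by (intro sum_mono) (auto simp: monotone_def)
    also have "\<dots> \<le> (\<Sum>i. p i)" using p(2) by (intro sum_le_suminf) auto
    finally have le: "Suc i * p i \<le> n" using p(3) by simp
    then have "p i \<le> n" by simp
    moreover have "p i = 0" if "n \<le> i"
    proof (rule ccontr)
      assume "p i \<noteq> 0"
      have "Suc i * 1 \<le> Suc i * p i" using \<open>p i \<noteq> 0\<close> by (intro mult_le_mono2) simp
      also note le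
      finally show False using that by simp
    qed
    ultimately show "(i \<in> {..<n} \<longrightarrow> p i \<in> {..n}) \<and> (i \<notin> {..<n} \<longrightarrow> p i = 0)" by auto
  qed
qed (intro finite_set_of_finite_funs; simp)

lemma zero_in_partitions_upto: "(\<lambda>_. 0) \<in> partitions_upto n"
  by (simp add: partitions_upto_def integer_partition_def monotone_def)

lemma high_minimizers_nonempty: "high_minimizers n v \<noteq> {}"
  using ex_is_arg_min_if_finite[OF finite_partitions_upto] zero_in_partitions_upto
  unfolding high_minimizers_def by blast

lemma low_minimizers_nonempty: "low_minimizers n v \<noteq> {}"
  using ex_is_arg_min_if_finite[OF finite_partitions_upto] zero_in_partitions_upto
  unfolding low_minimizers_def by blast

end

theory Submission
  imports Defs
begin

text \<open>
  Cumulative prevalence is an isometry for the l1 distance and turns unions into sums. Hence a change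
  by 1 of one part moves exactly one of the two noised vectors, in one entry and by 1, which the
  geometric noise hides up to the factor \<open>exp \<epsilon>\<close>; the rest is post-processing. For the error, the
  true high and low partitions are admissible in the minimizations, so each projection at most
  doubles the l1 norm of its noise. There are \<open>2 m = O(sqrt n)\<close> noise entries of mean absolute value
  at most \<open>4 exp (-\<epsilon>)\<close> each.
\<close>

section \<open>The l1 distance\<close>

lemma l1_dist_commute: "l1_dist v w = l1_dist w v"
  by (simp add: l1_dist_def abs_minus_commute)

text \<open>Summation of an entrywise bound. Six separate vectors are allowed so that it yields the
  triangle inequality as well as the estimate for unions, where prevalences add.\<close>

lemma l1_dist_add_le:
  assumes "\<And>i. \<bar>u i - w i\<bar> \<le> \<bar>a i - b i\<bar> + \<bar>c i - d i\<bar>"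
  shows "l1_dist u w \<le> l1_dist a b + l1_dist c d"
proof -
  have "l1_dist u w
      \<le> (\<Sum>i. ennreal (real_of_int \<bar>a i - b i\<bar>) + ennreal (real_of_int \<bar>c i - d i\<bar>))"
    unfolding l1_dist_def
  proof (intro suminf_le)
    fix i
    have "real_of_int \<bar>u i - w i\<bar> \<le> real_of_int \<bar>a i - b i\<bar> + real_of_int \<bar>c i - d i\<bar>"
      using assms[of i] by linarith
    then show "ennreal (real_of_int \<bar>u i - w i\<bar>)
        \<le> ennreal (real_of_int \<bar>a i - b i\<bar>) + ennreal (real_of_int \<bar>c i - d i\<bar>)"
      by (simp flip: ennreal_plus)
  qed auto
  also have "\<dots> = l1_dist a b + l1_dist c d"
    unfolding l1_dist_def by (intro suminf_add[symmetric]) auto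
  finally show ?thesis .
qed

lemma l1_dist_triangle: "l1_dist u w \<le> l1_dist u v + l1_dist v w"
  by (rule l1_dist_add_le) linarith

text \<open>Entries are integers, so one differing entry already uses up the whole distance 1. The
  infinite sum is avoided by testing finite index sets with one or two elements.\<close>

lemma l1_dist_le_1D:
  assumes "l1_dist v w \<le> 1" "v k \<noteq> w k"
  shows "\<bar>v k - w k\<bar> = 1" "\<And>i. i \<noteq> k \<Longrightarrow> v i = w i"
proof -
  have sum: "(\<Sum>i\<in>I. \<bar>v i - w i\<bar>) \<le> 1" if "finite I" for I
  proof -
    have "ennreal (\<Sum>i\<in>I. real_of_int \<bar>v i - w i\<bar>) = (\<Sum>i\<in>I. ennreal (real_of_int \<bar>v i - w i\<bar>))"
      by (subst sum_ennreal) auto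
    also have "\<dots> \<le> l1_dist v w"
      unfolding l1_dist_def using that by (intro sum_le_suminf) auto
    also have "\<dots> \<le> ennreal 1" using assms(1) by simp
    finally have "(\<Sum>i\<in>I. real_of_int \<bar>v i - w i\<bar>) \<le> 1"
      by (subst (asm) ennreal_le_iff) auto
    then show ?thesis
      by (simp flip: of_int_sum of_int_abs of_int_diff)
  qed
  show 1: "\<bar>v k - w k\<bar> = 1" using sum[of "{k}"] assms(2) by simp
  show "v i = w i" if "i \<noteq> k" for i
    using sum[of "{i, k}"] 1 that by simp
qed

section \<open>Partitions and cumulative prevalences\<close>

text \<open>The entries \<open>p 0\<close>, ..., \<open>p i\<close> are all at least
  \<open>p i\<close>; with indices from 0 there are \<open>Suc i\<close> of them.\<close>

lemma integer_partition_bound: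
  assumes "integer_partition p"
  shows "Suc i * p i \<le> (\<Sum>i. p i)"
proof -
  have p: "antimono p" "summable p" using assms by (auto simp: integer_partition_def)
  have "Suc i * p i = (\<Sum>j<Suc i. p i)" by simp
  also have "\<dots> \<le> (\<Sum>j<Suc i. p j)"
    using p(1) by (intro sum_mono) (auto simp: monotone_def)
  also have "\<dots> \<le> (\<Sum>i. p i)" using p(2) by (intro sum_le_suminf) auto
  finally show ?thesis .
qed

lemma finite_ge_integer_partition:
  assumes "integer_partition p" "r > 0"
  shows "finite {i. r \<le> p i}"
proof (rule finite_subset)
  show "{i. r \<le> p i} \<subseteq> {..suminf p}"
  proof safe
    fix i assume "r \<le> p i"
    then have "Suc i * 1 \<le> Suc i * p i" using assms(2) by (intro mult_le_mono2) simp
    also note integer_partition_bound[OF assms(1)]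
    finally show "i \<le> suminf p" by simp
  qed
qed simp

lemma integer_partition_antimono: "integer_partition p \<Longrightarrow> i \<le> j \<Longrightarrow> p j \<le> p i"
  by (auto simp: integer_partition_def monotone_def)

lemma integer_partitionI:
  assumes "\<And>i j. i \<le> j \<Longrightarrow> p j \<le> p i" "finite {i. 0 < p i}"
  shows "integer_partition p"
  using assms(1) summable_finite[OF assms(2), of p]
  by (auto simp: integer_partition_def monotone_def)

text \<open>The index set is finite and downward closed, hence an initial segment of the length of
  its cardinality. This makes \<open>cumulative_prevalences p\<close> the conjugate partition:
  \<open>r < p i\<close> iff \<open>i < cumulative_prevalences p r\<close>.\<close>

lemma ge_integer_partition_eq:
  assumes "integer_partition p"
  shows "{i. Suc r \<le> p i} = {..<cumulative_prevalences p r}"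
proof -
  let ?A = "{i. Suc r \<le> p i}"
  have fin: "finite ?A" using finite_ge_integer_partition[OF assms] by simp
  have down: "j \<in> ?A" if "i \<in> ?A" "j \<le> i" for i j
    using integer_partition_antimono[OF assms that(2)] that(1) by simp
  have *: "i < card ?A" if "i \<in> ?A" for i
  proof -
    have "{..i} \<subseteq> ?A" using down[OF that] by blast
    then have "card {..i} \<le> card ?A" using fin by (intro card_mono) auto
    then show ?thesis by simp
  qed
  have "?A = {..<card ?A}"
    by (rule card_subset_eq) (use * in auto)
  then show ?thesis
    by (simp add: cumulative_prevalences_def cumulative_prevalence_def)
qed

text \<open>The initial segments of lengths \<open>a\<close> and \<open>b\<close> differ in exactly
  \<bar>a - b\<bar> places. Writing each entry of a distance this way turns the distance into a
  count of cells.\<close>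

lemma suminf_of_bool_xor:
  "(\<Sum>i. of_bool ((i < a) \<noteq> (i < b)) :: ennreal) = ennreal (real_of_int \<bar>int a - int b\<bar>)"
proof -
  have eq: "{i. (i < a) \<noteq> (i < b)} = {min a b..<max a b}" by auto
  have "(\<Sum>i. of_bool ((i < a) \<noteq> (i < b)) :: ennreal)
      = (\<Sum>i\<in>{min a b..<max a b}. of_bool ((i < a) \<noteq> (i < b)))"
    by (intro suminf_finite) auto
  also have "\<dots> = (\<Sum>i\<in>{min a b..<max a b}. 1)"
    by (intro sum.cong) auto
  also have "\<dots> = of_nat (max a b - min a b)" by simp
  also have "\<dots> = ennreal (real_of_int \<bar>int a - int b\<bar>)"
    by (subst ennreal_of_nat_eq_real_of_nat) (auto simp: max_def min_def of_nat_diff)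
  finally show ?thesis .
qed

text \<open>Tonelli, with one of the sums read as an integral over the counting measure.\<close>

lemma suminf_swap_ennreal:
  fixes f :: "nat \<Rightarrow> nat \<Rightarrow> ennreal"
  shows "(\<Sum>i. \<Sum>j. f i j) = (\<Sum>j. \<Sum>i. f i j)"
  using nn_integral_suminf[of "\<lambda>j i. f i j" "count_space UNIV"]
  by (simp add: nn_integral_count_space_nat)

text \<open>Both sides count the cells of the symmetric difference of the two Young diagrams, one by rows
  and the other by columns.\<close>

lemma l1_dist_cumulative_prevalences:
  assumes "integer_partition p" "integer_partition q"
  shows "l1_dist (int \<circ> cumulative_prevalences p) (int \<circ> cumulative_prevalences q)
       = l1_dist (int \<circ> p) (int \<circ> q)"
proof -
  have iff: "r < x i \<longleftrightarrow> i < cumulative_prevalences x r" if "integer_partition x" for x r i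
    using ge_integer_partition_eq[OF that, of r] by (auto simp: Suc_le_eq)
  have "l1_dist (int \<circ> p) (int \<circ> q) = (\<Sum>i. \<Sum>r. of_bool ((r < p i) \<noteq> (r < q i)))"
    unfolding l1_dist_def suminf_of_bool_xor o_def ..
  also have "\<dots> = (\<Sum>r. \<Sum>i. of_bool ((r < p i) \<noteq> (r < q i)))"
    by (rule suminf_swap_ennreal)
  also have "\<dots> = l1_dist (int \<circ> cumulative_prevalences p) (int \<circ> cumulative_prevalences q)"
    unfolding l1_dist_def suminf_of_bool_xor o_def iff[OF assms(1)] iff[OF assms(2)] ..
  finally show ?thesis by simp
qed

section \<open>Unions of partitions\<close>

lemma size_filter_positive_parts:
  assumes "integer_partition p"
  shows "size (filter_mset (\<lambda>x. Suc r \<le> x) (positive_parts p)) = cumulative_prevalences p r"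
proof -
  have "{i \<in> {i. 0 < p i}. Suc r \<le> p i} = {i. Suc r \<le> p i}" by auto
  moreover have "finite {i. 0 < p i}"
    using finite_ge_integer_partition[OF assms, of 1] by (simp add: Suc_le_eq)
  ultimately show ?thesis
    by (simp add: positive_parts_def filter_mset_image_mset cumulative_prevalences_def
        cumulative_prevalence_def)
qed

lemma integer_partition_union: "integer_partition (partition_union p q)"
proof (rule integer_partitionI)
  define ys where "ys = sorted_list_of_multiset (positive_parts p + positive_parts q)"
  have eq: "partition_union p q = (\<lambda>i. if i < length ys then rev ys ! i else 0)"
    unfolding partition_union_def ys_def Let_def length_rev ..
  have "sorted ys" by (simp add: ys_def)
  then show "partition_union p q j \<le> partition_union p q i" if "i \<le> j" for i j
    using that by (auto simp: eq rev_nth intro!: sorted_nth_mono)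
  have "{i. 0 < partition_union p q i} \<subseteq> {..<length ys}"
    by (auto simp: eq split: if_splits)
  then show "finite {i. 0 < partition_union p q i}"
    by (rule finite_subset) simp
qed

text \<open>Counting the parts above a threshold is additive on multisets. The threshold
  \<open>Suc r\<close> is positive, so neither the omitted zeros nor the padding are
  counted.\<close>

lemma cumulative_prevalences_union:
  assumes "integer_partition p" "integer_partition q"
  shows "cumulative_prevalences (partition_union p q) r
       = cumulative_prevalences p r + cumulative_prevalences q r"
proof -
  define xs where "xs = rev (sorted_list_of_multiset (positive_parts p + positive_parts q))"
  have eq: "partition_union p q = (\<lambda>i. if i < length xs then xs ! i else 0)"
    unfolding partition_union_def xs_def Let_def ..
  have "{i. Suc r \<le> partition_union p q i} = {i. i < length xs \<and> Suc r \<le> xs ! i}"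
    by (auto simp: eq split: if_splits)
  then have "cumulative_prevalences (partition_union p q) r = length (filter (\<lambda>x. Suc r \<le> x) xs)"
    by (simp add: cumulative_prevalences_def cumulative_prevalence_def length_filter_conv_card)
  also have "\<dots> = size (filter_mset (\<lambda>x. Suc r \<le> x) (mset xs))"
    by (simp flip: mset_filter)
  also have "mset xs = positive_parts p + positive_parts q" by (simp add: xs_def)
  finally show ?thesis
    using size_filter_positive_parts[OF assms(1), of r] size_filter_positive_parts[OF assms(2), of r]
    by simp
qed

text \<open>On the side of prevalences, \<open>p\<close> is the sum for \<open>h'\<close> and
  \<open>l'\<close> and the union is the sum for \<open>h\<close> and \<open>l\<close>, so the
  triangle inequality separates the two errors. Only the high term is carried back to parts: each
  term then has the form minimized in its own projection.\<close>

lemma l1_dist_union_le: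
  assumes "integer_partition h" "integer_partition l" "integer_partition h'" "integer_partition l'"
    and "integer_partition p"
    and "\<And>r. cumulative_prevalences p r = cumulative_prevalences h' r + cumulative_prevalences l' r"
  shows "l1_dist (int \<circ> partition_union h l) (int \<circ> p)
       \<le> l1_dist (int \<circ> h) (int \<circ> h')
         + l1_dist (int \<circ> cumulative_prevalences l) (int \<circ> cumulative_prevalences l')"
proof -
  have "l1_dist (int \<circ> partition_union h l) (int \<circ> p)
      = l1_dist (int \<circ> cumulative_prevalences (partition_union h l)) (int \<circ> cumulative_prevalences p)"
    using assms(5) by (simp add: l1_dist_cumulative_prevalences integer_partition_union)
  also have "\<dots> \<le> l1_dist (int \<circ> cumulative_prevalences h) (int \<circ> cumulative_prevalences h')
         + l1_dist (int \<circ> cumulative_prevalences l) (int \<circ> cumulative_prevalences l')"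
    by (rule l1_dist_add_le) (simp add: cumulative_prevalences_union assms)
  finally show ?thesis
    using assms by (simp add: l1_dist_cumulative_prevalences)
qed

section \<open>Partitions of bounded size, their heads and tails\<close>

lemma partitions_uptoD:
  assumes "p \<in> partitions_upto n"
  shows "integer_partition p" "(\<Sum>i<k. p i) \<le> n" "Suc i * p i \<le> n"
proof -
  show p: "integer_partition p" using assms by (simp add: partitions_upto_def)
  have le: "suminf p \<le> n" using assms by (simp add: partitions_upto_def)
  show "Suc i * p i \<le> n"
    using integer_partition_bound[OF p, of i] le by linarith
  have "(\<Sum>i<k. p i) \<le> suminf p"
    using p by (intro sum_le_suminf) (auto simp: integer_partition_def)
  then show "(\<Sum>i<k. p i) \<le> n" using le by linarith
qed

lemma partitions_uptoI:
  assumes "integer_partition p" "\<And>k. (\<Sum>i<k. p i) \<le> n"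
  shows "p \<in> partitions_upto n"
  using assms by (auto simp: partitions_upto_def integer_partition_def intro!: suminf_le_const)

lemma truncate_seq_in_partitions_upto:
  assumes "p \<in> partitions_upto n"
  shows "truncate_seq m p \<in> partitions_upto n"
proof (rule partitions_uptoI)
  note p = partitions_uptoD[OF assms]
  have "{i. 0 < truncate_seq m p i} \<subseteq> {..<m}" by (auto simp: truncate_seq_def split: if_splits)
  then show "integer_partition (truncate_seq m p)"
    using integer_partition_antimono[OF p(1)]
    by (intro integer_partitionI) (auto simp: truncate_seq_def intro: finite_subset)
  fix k
  have "(\<Sum>i<k. truncate_seq m p i) \<le> (\<Sum>i<k. p i)"
    by (intro sum_mono) (auto simp: truncate_seq_def)
  then show "(\<Sum>i<k. truncate_seq m p i) \<le> n" using p(2)[of k] by linarith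
qed

lemma integer_partition_shift:
  assumes "integer_partition p"
  shows "integer_partition (\<lambda>i. p (m + i))"
proof (rule integer_partitionI)
  show "p (m + j) \<le> p (m + i)" if "i \<le> j" for i j
    using integer_partition_antimono[OF assms] that by simp
  have "finite ((+) m -` {i. 1 \<le> p i})"
    by (intro finite_vimageI finite_ge_integer_partition assms) auto
  then show "finite {i. 0 < p (m + i)}" by (simp add: vimage_def Suc_le_eq)
qed

lemma shift_in_partitions_upto:
  assumes "p \<in> partitions_upto n"
  shows "(\<lambda>i. p (m + i)) \<in> partitions_upto n"
proof (rule partitions_uptoI)
  note p = partitions_uptoD[OF assms]
  show "integer_partition (\<lambda>i. p (m + i))" using p(1) by (rule integer_partition_shift)
  fix k
  have "(\<Sum>i<k. p (m + i)) = (\<Sum>i\<in>(+) m ` {..<k}. p i)"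
    by (subst sum.reindex) auto
  also have "\<dots> \<le> (\<Sum>i<m+k. p i)" by (intro sum_mono2) auto
  finally show "(\<Sum>i<k. p (m + i)) \<le> n" using p(2)[of "m + k"] by linarith
qed

text \<open>Each index counted lies either below \<open>m\<close> or in the shifted tail; the zeros
  that pad the head stay below the positive threshold.\<close>

lemma cumulative_prevalences_split:
  assumes "integer_partition p"
  shows "cumulative_prevalences p r
       = cumulative_prevalences (truncate_seq m p) r + cumulative_prevalences (\<lambda>i. p (m + i)) r"
proof -
  let ?A = "{i. Suc r \<le> truncate_seq m p i}" and ?B = "(+) m ` {i. Suc r \<le> p (m + i)}"
  have fin: "finite {i. Suc r \<le> p i}" using finite_ge_integer_partition[OF assms] by simp
  have eq: "{i. Suc r \<le> p i} = ?A \<union> ?B"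
  proof safe
    fix i assume i: "Suc r \<le> p i" "i \<notin> ?B"
    then have "i < m"
      by (metis (mono_tags, lifting) image_eqI le_add_diff_inverse mem_Collect_eq not_less)
    then show "Suc r \<le> truncate_seq m p i" using i by (simp add: truncate_seq_def)
  qed (auto simp: truncate_seq_def split: if_splits)
  have "card {i. Suc r \<le> p i} = card ?A + card ?B"
    unfolding eq using fin[unfolded eq]
    by (intro card_Un_disjoint) (auto simp: truncate_seq_def split: if_splits)
  also have "card ?B = card {i. Suc r \<le> p (m + i)}" by (intro card_image) auto
  finally show ?thesis by (simp add: cumulative_prevalences_def cumulative_prevalence_def)
qed

text \<open>A part behind the \<open>m\<close> largest is smaller than \<open>m\<close>, so step (3) truncates only zeros.\<close>

lemma truncate_cumulative_prevalences_shift: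
  assumes "p \<in> partitions_upto n" "n \<le> m * m"
  shows "truncate_seq m (cumulative_prevalences (\<lambda>i. p (m + i)))
       = cumulative_prevalences (\<lambda>i. p (m + i))"
proof
  fix r
  have "cumulative_prevalences (\<lambda>i. p (m + i)) r = 0" if "m \<le> r"
  proof -
    have "p (m + i) < Suc r" for i
    proof (rule ccontr)
      assume "\<not> p (m + i) < Suc r"
      \<comment> \<open>A part of size at least \<open>Suc m\<close> at index \<open>m + i\<close>
        forces at least \<open>Suc m\<close> parts of that size, for a total above
        \<open>m * m\<close>.\<close>
      then have "Suc m * Suc m \<le> Suc (m + i) * p (m + i)"
        using that by (intro mult_le_mono) auto
      also have "\<dots> \<le> n" by (rule partitions_uptoD(3)[OF assms(1)])
      finally show False using assms(2) by simp
    qed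
    then have "{i. Suc r \<le> p (m + i)} = {}" by (simp add: not_le)
    then show ?thesis
      by (simp add: cumulative_prevalences_def cumulative_prevalence_def)
  qed
  then show "truncate_seq m (cumulative_prevalences (\<lambda>i. p (m + i))) r
      = cumulative_prevalences (\<lambda>i. p (m + i)) r"
    by (auto simp: truncate_seq_def)
qed

text \<open>Go through \<open>v\<close>: the minimizer \<open>q\<close> is no farther from
  \<open>v\<close> than the competitor \<open>q'\<close>. The map \<open>f\<close> covers both
  projections, onto parts and onto prevalences.\<close>

lemma minimizer_dist_le:
  assumes "is_arg_min (\<lambda>q. l1_dist v (f q)) (\<lambda>q. q \<in> A) q" "q' \<in> A"
  shows "l1_dist (f q) (f q') \<le> 2 * l1_dist v (f q')"
proof -
  have "l1_dist (f q) (f q') \<le> l1_dist (f q) v + l1_dist v (f q')"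
    by (rule l1_dist_triangle)
  also have "l1_dist (f q) v = l1_dist v (f q)" by (rule l1_dist_commute)
  also have "l1_dist v (f q) \<le> l1_dist v (f q')"
    using assms by (auto simp: is_arg_min_def not_less)
  finally show ?thesis by (simp add: mult_2)
qed

section \<open>Privacy\<close>

text \<open>Post-processing: a pointwise bound on the densities of the first draw survives any
  randomized continuation \<open>f\<close>, since the probability of \<open>S\<close> is linear in
  that density.\<close>

lemma prob_bind_pmf_le:
  assumes "\<And>z. pmf M z \<le> c * pmf M' z" "c \<ge> 0"
  shows "measure_pmf.prob (bind_pmf M f) S \<le> c * measure_pmf.prob (bind_pmf M' f) S"
proof -
  have "emeasure (bind_pmf M f) S = (\<integral>\<^sup>+z. ennreal (pmf M z) * emeasure (f z) S \<partial>count_space UNIV)"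
    by (simp add: nn_integral_measure_pmf)
  also have "\<dots> \<le> (\<integral>\<^sup>+z. ennreal c * (ennreal (pmf M' z) * emeasure (f z) S) \<partial>count_space UNIV)"
  proof (intro nn_integral_mono)
    fix z
    have "ennreal (pmf M z) \<le> ennreal c * ennreal (pmf M' z)"
      using assms(1)[of z] assms(2) by (simp flip: ennreal_mult add: ennreal_leI)
    then show "ennreal (pmf M z) * emeasure (f z) S
        \<le> ennreal c * (ennreal (pmf M' z) * emeasure (f z) S)"
      by (simp add: mult_right_mono flip: mult.assoc)
  qed
  also have "\<dots> = ennreal c * emeasure (bind_pmf M' f) S"
    by (simp add: nn_integral_cmult nn_integral_measure_pmf)
  finally show ?thesis
    using assms(2)
    by (simp add: measure_pmf.emeasure_eq_measure flip: ennreal_mult)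
qed

lemma two_sided_geometric_ratio:
  assumes "\<epsilon> > 0" "\<bar>a - b\<bar> = 1"
  shows "pmf (two_sided_geometric_pmf (exp (- \<epsilon>))) a
       \<le> exp \<epsilon> * pmf (two_sided_geometric_pmf (exp (- \<epsilon>))) b"
proof -
  define \<alpha> where "\<alpha> = exp (- \<epsilon>)"
  have \<alpha>: "0 < \<alpha>" "\<alpha> < 1" "exp \<epsilon> * \<alpha> = 1"
    using assms(1) by (auto simp: \<alpha>_def simp flip: exp_add)
  \<comment> \<open>Here \<bar>b\<bar> \<le> \<bar>a\<bar> + 1 and the base is below 1; multiplying
    by \<open>exp \<epsilon>\<close>, the inverse of \<alpha>, then cancels the extra power.\<close>
  have "\<alpha> ^ Suc (nat \<bar>a\<bar>) \<le> \<alpha> ^ nat \<bar>b\<bar>"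
    using \<alpha> assms(2) by (intro power_decreasing) auto
  then have "exp \<epsilon> * \<alpha> ^ Suc (nat \<bar>a\<bar>) \<le> exp \<epsilon> * \<alpha> ^ nat \<bar>b\<bar>" by simp
  also have "exp \<epsilon> * \<alpha> ^ Suc (nat \<bar>a\<bar>) = (exp \<epsilon> * \<alpha>) * \<alpha> ^ nat \<bar>a\<bar>" by simp
  finally have "\<alpha> ^ nat \<bar>a\<bar> \<le> exp \<epsilon> * \<alpha> ^ nat \<bar>b\<bar>" by (simp add: \<alpha>(3))
  then have "\<alpha> ^ nat \<bar>a\<bar> * ((1 - \<alpha>) / (1 + \<alpha>)) \<le> exp \<epsilon> * \<alpha> ^ nat \<bar>b\<bar> * ((1 - \<alpha>) / (1 + \<alpha>))"
    using \<alpha> by (intro mult_right_mono) auto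
  then show ?thesis
    using \<alpha> by (simp add: pmf_two_sided_geometric mult.assoc flip: \<alpha>_def)
qed

text \<open>Both noisy releases of the algorithm are instances of this one mechanism, so its privacy
  and its error are analysed only once.\<close>

definition noised :: "real \<Rightarrow> nat \<Rightarrow> (nat \<Rightarrow> nat) \<Rightarrow> (nat \<Rightarrow> int) pmf" where
  "noised \<epsilon> m v = map_pmf (\<lambda>x i. int (v i) + x i) (geometric_noise (exp (- \<epsilon>)) m)"

lemma pmf_noised:
  "pmf (noised \<epsilon> m v) z = pmf (geometric_noise (exp (- \<epsilon>)) m) (\<lambda>i. z i - int (v i))"
proof -
  have "inj (\<lambda>x i. int (v i) + x i)"
    by (auto simp: inj_on_def fun_eq_iff)
  then have "pmf (noised \<epsilon> m v) ((\<lambda>x i. int (v i) + x i) (\<lambda>i. z i - int (v i)))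
      = pmf (geometric_noise (exp (- \<epsilon>)) m) (\<lambda>i. z i - int (v i))"
    unfolding noised_def by (rule pmf_map_inj')
  then show ?thesis by simp
qed

text \<open>Unless the vectors are equal, they differ by 1 in a single entry, so only one factor of
  the product density changes. Entries from \<open>m\<close> on carry no noise and would reveal a
  difference, hence the agreement demanded there.\<close>

lemma pmf_noised_le:
  assumes "\<epsilon> > 0" "l1_dist (int \<circ> v) (int \<circ> w) \<le> 1" "\<And>i. i \<ge> m \<Longrightarrow> v i = w i"
  shows "pmf (noised \<epsilon> m v) z \<le> exp \<epsilon> * pmf (noised \<epsilon> m w) z"
proof (cases "v = w")
  case True
  have "1 * pmf (noised \<epsilon> m w) z \<le> exp \<epsilon> * pmf (noised \<epsilon> m w) z"
    using assms(1) by (intro mult_right_mono) auto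
  then show ?thesis using True by simp
next
  case False
  then obtain k where k: "v k \<noteq> w k" by auto
  then have "k < m" using assms(3) not_less by blast
  have k1: "\<bar>int (v k) - int (w k)\<bar> = 1" and ne: "\<And>i. i \<noteq> k \<Longrightarrow> v i = w i"
    using l1_dist_le_1D[OF assms(2), of k] k by auto
  define G where "G = two_sided_geometric_pmf (exp (- \<epsilon>))"
  \<comment> \<open>The density of \<open>Pi_pmf\<close> vanishes unless the noise has its default
    value 0 outside \<open>{..<m}\<close>; this condition is the same for \<open>v\<close> and
    \<open>w\<close>.\<close>
  have supp: "(\<forall>i. i \<notin> {..<m} \<longrightarrow> z i - int (v i) = 0)
      \<longleftrightarrow> (\<forall>i. i \<notin> {..<m} \<longrightarrow> z i - int (w i) = 0)"
    using assms(3) by auto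
  have "(\<Prod>i<m. pmf G (z i - int (v i)))
      \<le> (\<Prod>i<m. (if i = k then exp \<epsilon> else 1) * pmf G (z i - int (w i)))"
  proof (intro prod_mono conjI)
    fix i
    show "pmf G (z i - int (v i)) \<le> (if i = k then exp \<epsilon> else 1) * pmf G (z i - int (w i))"
    proof (cases "i = k")
      case True
      have "\<bar>(z k - int (v k)) - (z k - int (w k))\<bar> = 1" using k1 by linarith
      then show ?thesis
        using two_sided_geometric_ratio[OF assms(1)] True by (simp add: G_def)
    qed (use ne in auto)
  qed simp
  also have "\<dots> = exp \<epsilon> * (\<Prod>i<m. pmf G (z i - int (w i)))"
    using \<open>k < m\<close> by (simp add: prod.distrib prod.delta)
  finally show ?thesis
    using supp by (simp add: pmf_noised geometric_noise_def pmf_Pi G_def prod_nonneg)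
qed

section \<open>Privacy of the whole algorithm\<close>

lemma dp_anon_hist_eq:
  fixes n :: nat
  defines "m \<equiv> nat \<lceil>sqrt (real n)\<rceil>"
  shows "dp_anon_hist H L \<epsilon> n p =
     noised \<epsilon> m (truncate_seq m p) \<bind> (\<lambda>u.
     noised \<epsilon> m (truncate_seq m (cumulative_prevalences (\<lambda>i. p (m + i)))) \<bind> (\<lambda>v.
     H u \<bind> (\<lambda>h. L v \<bind> (\<lambda>l. return_pmf (partition_union h l)))))"
  by (simp add: dp_anon_hist_def noised_def bind_map_pmf m_def Let_def)

lemma l1_dist_truncate_le:
  "l1_dist (int \<circ> truncate_seq m v) (int \<circ> truncate_seq m w) \<le> l1_dist (int \<circ> v) (int \<circ> w)"
  unfolding l1_dist_def by (intro suminf_le) (auto simp: truncate_seq_def)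

lemma l1_dist_shift_le:
  "l1_dist (int \<circ> (\<lambda>i. v (m + i))) (int \<circ> (\<lambda>i. w (m + i))) \<le> l1_dist (int \<circ> v) (int \<circ> w)"
proof -
  have "l1_dist (int \<circ> v) (int \<circ> w)
      = (\<Sum>i. ennreal (real_of_int \<bar>int (v (i + m)) - int (w (i + m))\<bar>))
        + (\<Sum>i<m. ennreal (real_of_int \<bar>int (v i) - int (w i)\<bar>))"
    unfolding l1_dist_def o_def by (rule suminf_offset) simp
  then show ?thesis by (simp add: l1_dist_def add.commute)
qed

lemma dp_anon_hist_private:
  assumes "\<epsilon> > 0"
  shows "differentially_private \<epsilon> 0 (partitions_upto n) (dp_anon_hist H L \<epsilon> n)"
  unfolding differentially_private_def
proof (intro ballI impI allI)
  fix p p' S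
  assume "neighbors p p'"
  then have p: "integer_partition p" "integer_partition p'" and d: "l1_dist (int \<circ> p) (int \<circ> p') \<le> 1"
    by (auto simp: neighbors_def)
  define m where "m = nat \<lceil>sqrt (real n)\<rceil>"
  define hi where "hi q = truncate_seq m q" for q
  define lo where "lo q = truncate_seq m (cumulative_prevalences (\<lambda>i. q (m + i)))" for q
  define R where "R = (\<lambda>u v. H u \<bind> (\<lambda>h. L v \<bind> (\<lambda>l. return_pmf (partition_union h l))))"
  have eq: "dp_anon_hist H L \<epsilon> n q
      = noised \<epsilon> m (hi q) \<bind> (\<lambda>u. noised \<epsilon> m (lo q) \<bind> R u)" for q
    by (simp add: dp_anon_hist_eq m_def hi_def lo_def R_def)
  \<comment> \<open>The two noise vectors are independent, so the low one may be drawn first: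
    \<open>prob_bind_pmf_le\<close> compares the outermost draw only.\<close>
  have eq': "dp_anon_hist H L \<epsilon> n q
      = noised \<epsilon> m (lo q) \<bind> (\<lambda>v. noised \<epsilon> m (hi q) \<bind> (\<lambda>u. R u v))" for q
    unfolding eq by (rule bind_commute_pmf)
  show "measure_pmf.prob (dp_anon_hist H L \<epsilon> n p) S
      \<le> exp \<epsilon> * measure_pmf.prob (dp_anon_hist H L \<epsilon> n p') S + 0"
  proof (cases "hi p = hi p'")
    case False
    then obtain k where k: "hi p k \<noteq> hi p' k" by auto
    then have "k < m" "p k \<noteq> p' k" by (auto simp: hi_def truncate_seq_def split: if_splits)
    \<comment> \<open>Entry \<open>k\<close>, below \<open>m\<close>, exhausts the distance; the
      tails and hence the low vectors coincide.\<close>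
    then have "p (m + i) = p' (m + i)" for i
      using l1_dist_le_1D(2)[OF d, of k "m + i"] by simp
    then have "lo p = lo p'" by (simp add: lo_def)
    moreover have "pmf (noised \<epsilon> m (hi p)) z \<le> exp \<epsilon> * pmf (noised \<epsilon> m (hi p')) z" for z
      using assms order_trans[OF l1_dist_truncate_le d]
      by (intro pmf_noised_le) (auto simp: hi_def truncate_seq_def)
    ultimately show ?thesis
      unfolding eq by (simp add: prob_bind_pmf_le)
  next
    case True
    \<comment> \<open>Only the low vector can differ now. Shifting and truncating do not increase
      the distance and prevalences preserve it, so the bound 1 passes to \<open>lo\<close>.\<close>
    have "l1_dist (int \<circ> lo p) (int \<circ> lo p')
        \<le> l1_dist (int \<circ> cumulative_prevalences (\<lambda>i. p (m + i)))
                  (int \<circ> cumulative_prevalences (\<lambda>i. p' (m + i)))"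
      unfolding lo_def by (rule l1_dist_truncate_le)
    also have "\<dots> = l1_dist (int \<circ> (\<lambda>i. p (m + i))) (int \<circ> (\<lambda>i. p' (m + i)))"
      using p by (intro l1_dist_cumulative_prevalences integer_partition_shift)
    also have "\<dots> \<le> l1_dist (int \<circ> p) (int \<circ> p')" by (rule l1_dist_shift_le)
    also note d
    finally have "pmf (noised \<epsilon> m (lo p)) z \<le> exp \<epsilon> * pmf (noised \<epsilon> m (lo p')) z" for z
      using assms by (intro pmf_noised_le) (auto simp: lo_def truncate_seq_def)
    then show ?thesis
      unfolding eq' True by (simp add: prob_bind_pmf_le)
  qed
qed

section \<open>Error\<close>

text \<open>The derivative of the geometric series times \<alpha>, reindexed; the term at 0
  vanishes.\<close>

lemma sums_nat_power:
  fixes \<alpha> :: real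
  assumes "0 < \<alpha>" "\<alpha> < 1"
  shows "(\<lambda>k. real k * \<alpha> ^ k) sums (\<alpha> / (1 - \<alpha>)\<^sup>2)"
proof -
  have "(\<lambda>k. \<alpha> * (of_nat (Suc k) * \<alpha> ^ k)) sums (\<alpha> * (1 / (1 - \<alpha>)\<^sup>2))"
    using assms by (intro sums_mult geometric_deriv_sums) auto
  then have "(\<lambda>k. real (Suc k) * \<alpha> ^ Suc k) sums (\<alpha> / (1 - \<alpha>)\<^sup>2)"
    by (simp add: mult_ac)
  then show ?thesis
    by (subst (asm) sums_Suc_iff) simp
qed

text \<open>Each half-line contributes a series of the form \<open>k * \<alpha> ^ k\<close>, giving
  in total at most 2 \<alpha> / (1 - \<alpha>^2). Since \<alpha> \<le> 1/2, the denominator is at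
  least 1/2.\<close>

lemma expectation_two_sided_geometric_le:
  assumes "0 < \<alpha>" "\<alpha> \<le> 1 / 2"
  shows "(\<integral>\<^sup>+i. ennreal (real_of_int \<bar>i\<bar>) \<partial>two_sided_geometric_pmf \<alpha>) \<le> ennreal (4 * \<alpha>)"
proof -
  define c where "c = (1 - \<alpha>) / (1 + \<alpha>)"
  have c: "c \<ge> 0" using assms by (simp add: c_def)
  define f where "f i = ennreal (real (nat \<bar>i\<bar>) * \<alpha> ^ nat \<bar>i\<bar> * c)" for i :: int
  have half: "(\<integral>\<^sup>+i. f i * indicator (range g) i \<partial>count_space UNIV) = ennreal (\<alpha> / (1 - \<alpha>)\<^sup>2 * c)"
    if g: "inj g" "\<And>k. nat \<bar>g k\<bar> = k" for g :: "nat \<Rightarrow> int"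
  proof -
    have "(\<integral>\<^sup>+i. f i * indicator (range g) i \<partial>count_space UNIV)
        = (\<integral>\<^sup>+i. f i \<partial>count_space (range g))"
      by (simp add: nn_integral_count_space_indicator)
    also have "\<dots> = (\<integral>\<^sup>+k. f (g k) \<partial>count_space UNIV)"
      using g(1) by (intro nn_integral_bij_count_space[symmetric] inj_on_imp_bij_betw) auto
    also have "\<dots> = (\<Sum>k. ennreal (real k * \<alpha> ^ k * c))"
      by (simp add: nn_integral_count_space_nat f_def g(2))
    also have "\<dots> = ennreal (\<alpha> / (1 - \<alpha>)\<^sup>2 * c)"
      using assms c by (intro suminf_ennreal_eq sums_mult2 sums_nat_power) auto
    finally show ?thesis .
  qed
  have "(\<integral>\<^sup>+i. ennreal (real_of_int \<bar>i\<bar>) \<partial>two_sided_geometric_pmf \<alpha>) = (\<integral>\<^sup>+i. f i \<partial>count_space UNIV)"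
    unfolding nn_integral_measure_pmf
  proof (intro nn_integral_cong)
    fix i
    show "ennreal (pmf (two_sided_geometric_pmf \<alpha>) i) * ennreal (real_of_int \<bar>i\<bar>) = f i"
      using assms c
      by (simp add: pmf_two_sided_geometric f_def c_def[symmetric] mult_ac flip: ennreal_mult)
  qed
  \<comment> \<open>The two half-lines overlap at 0, so a pointwise inequality is used; nothing is
    lost, as \<open>f 0\<close> is 0.\<close>
  also have "\<dots> \<le> (\<integral>\<^sup>+i. f i * indicator (range int) i
      + f i * indicator (range (\<lambda>k. - int k)) i \<partial>count_space UNIV)"
  proof (intro nn_integral_mono)
    fix i :: int
    have "i \<in> range int \<or> i \<in> range (\<lambda>k. - int k)" by (cases i rule: int_cases2) auto
    then show "f i \<le> f i * indicator (range int) i + f i * indicator (range (\<lambda>k. - int k)) i"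
      by (auto simp: indicator_def)
  qed
  also have "\<dots> = ennreal (\<alpha> / (1 - \<alpha>)\<^sup>2 * c) + ennreal (\<alpha> / (1 - \<alpha>)\<^sup>2 * c)"
    by (subst nn_integral_add) (auto simp: half inj_on_def)
  also have "\<dots> = ennreal (2 * (\<alpha> / (1 - \<alpha>)\<^sup>2 * c))"
    using assms c by (simp flip: ennreal_plus)
  also have "2 * (\<alpha> / (1 - \<alpha>)\<^sup>2 * c) = \<alpha> * (2 / ((1 - \<alpha>) * (1 + \<alpha>)))"
    using assms by (simp add: c_def divide_simps power2_eq_square)
  also have "ennreal \<dots> \<le> ennreal (4 * \<alpha>)"
  proof (intro ennreal_leI)
    have "\<alpha> * \<alpha> \<le> 1 / 2 * (1 / 2)" using assms by (intro mult_mono) auto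
    then have "1 / 2 \<le> (1 - \<alpha>) * (1 + \<alpha>)" by (simp add: algebra_simps)
    then have "2 / ((1 - \<alpha>) * (1 + \<alpha>)) \<le> 2 / (1 / 2)" by (intro divide_left_mono) auto
    then have "\<alpha> * (2 / ((1 - \<alpha>) * (1 + \<alpha>))) \<le> \<alpha> * 4"
      using assms by (intro mult_left_mono) auto
    then show "\<alpha> * (2 / ((1 - \<alpha>) * (1 + \<alpha>))) \<le> 4 * \<alpha>"
      by (simp only: mult.commute[of 4])
  qed
  finally show ?thesis .
qed

lemma expectation_l1_dist_noised_le:
  assumes "\<epsilon> \<ge> 1"
  shows "(\<integral>\<^sup>+u. l1_dist u (int \<circ> v) \<partial>noised \<epsilon> m v) \<le> ennreal (real m * (4 * exp (- \<epsilon>)))"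
proof -
  define G where "G = two_sided_geometric_pmf (exp (- \<epsilon>))"
  \<comment> \<open>From 1 + \<epsilon> \<le> \<open>exp \<epsilon>\<close>; this is where
    \<epsilon> \<ge> 1 gives the smallness needed for the mean of the noise.\<close>
  have "2 \<le> exp \<epsilon>" using exp_ge_add_one_self[of \<epsilon>] assms by linarith
  then have half: "exp (- \<epsilon>) \<le> 1 / 2" by (simp add: exp_minus field_simps)
  have "(\<integral>\<^sup>+u. l1_dist u (int \<circ> v) \<partial>noised \<epsilon> m v)
      = (\<integral>\<^sup>+x. (\<Sum>i. ennreal (real_of_int \<bar>x i\<bar>)) \<partial>geometric_noise (exp (- \<epsilon>)) m)"
    by (simp add: noised_def l1_dist_def)
  also have "\<dots> = (\<Sum>i. \<integral>\<^sup>+x. ennreal (real_of_int \<bar>x i\<bar>) \<partial>geometric_noise (exp (- \<epsilon>)) m)"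
    by (rule nn_integral_suminf) simp
  also have "\<dots> = (\<Sum>i. \<integral>\<^sup>+x. ennreal (real_of_int \<bar>x\<bar>) \<partial>map_pmf (\<lambda>x. x i) (geometric_noise (exp (- \<epsilon>)) m))"
    by simp
  \<comment> \<open>Entries outside \<open>{..<m}\<close> are constantly 0 and contribute
    nothing.\<close>
  also have "\<dots> = (\<Sum>i. if i < m then \<integral>\<^sup>+x. ennreal (real_of_int \<bar>x\<bar>) \<partial>G else 0)"
    by (intro suminf_cong) (auto simp: geometric_noise_def Pi_pmf_component G_def
        simp del: nn_integral_map_pmf)
  also have "\<dots> = (\<Sum>i<m. \<integral>\<^sup>+x. ennreal (real_of_int \<bar>x\<bar>) \<partial>G)"
    by (subst suminf_finite[of "{..<m}"]) auto
  also have "\<dots> \<le> (\<Sum>i<m. ennreal (4 * exp (- \<epsilon>)))"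
    unfolding G_def using half by (intro sum_mono expectation_two_sided_geometric_le) auto
  also have "\<dots> = ennreal (real m * (4 * exp (- \<epsilon>)))"
    by (subst sum_ennreal) auto
  finally show ?thesis .
qed

section \<open>Error of the whole algorithm\<close>

lemma nn_integral_pmf_le_const:
  assumes "\<And>x. x \<in> set_pmf M \<Longrightarrow> f x \<le> c"
  shows "(\<integral>\<^sup>+x. f x \<partial>measure_pmf M) \<le> c"
proof -
  have "(\<integral>\<^sup>+x. f x \<partial>measure_pmf M) \<le> (\<integral>\<^sup>+x. c \<partial>measure_pmf M)"
    using assms by (intro nn_integral_mono_AE) (simp add: AE_measure_pmf_iff)
  then show ?thesis by simp
qed

lemma dp_anon_hist_error:
  assumes "\<epsilon> \<ge> 1" "n \<ge> 1" "p \<in> partitions_upto n"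
    and H: "\<And>v. set_pmf (H v) \<subseteq> high_minimizers n v"
    and L: "\<And>v. set_pmf (L v) \<subseteq> low_minimizers n v"
  shows "(\<integral>\<^sup>+q. l1_dist (int \<circ> q) (int \<circ> p) \<partial>dp_anon_hist H L \<epsilon> n p)
       \<le> ennreal (32 * sqrt (real n) / exp \<epsilon>)"
proof -
  define m where "m = nat \<lceil>sqrt (real n)\<rceil>"
  have sqrt: "1 \<le> sqrt (real n)" using assms(2) by simp
  \<comment> \<open>Rounding up adds less than 1, which is at most
    \<open>sqrt (real n)\<close>.\<close>
  then have m: "sqrt (real n) \<le> real m" "real m \<le> 2 * sqrt (real n)"
    unfolding m_def by linarith+
  have "real n = sqrt (real n) * sqrt (real n)" by simp
  also have "\<dots> \<le> real m * real m" using m sqrt by (intro mult_mono) auto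
  finally have nm: "n \<le> m * m" by (simp flip: of_nat_mult)
  note p = partitions_uptoD(1)[OF assms(3)]
  define h0 where "h0 = truncate_seq m p"
  define l0 where "l0 = (\<lambda>i. p (m + i))"
  have h0: "h0 \<in> partitions_upto n" and l0: "l0 \<in> partitions_upto n"
    using truncate_seq_in_partitions_upto shift_in_partitions_upto assms(3)
    by (auto simp: h0_def l0_def)
  \<comment> \<open>The low noise is thus centred at the full prevalence vector of
    \<open>l0\<close>, which is what the second projection competes with.\<close>
  have trunc: "truncate_seq m (cumulative_prevalences l0) = cumulative_prevalences l0"
    unfolding l0_def using assms(3) nm by (rule truncate_cumulative_prevalences_shift)
  let ?hd = "\<lambda>u. 2 * l1_dist u (int \<circ> h0)"
    and ?ld = "\<lambda>v. 2 * l1_dist v (int \<circ> cumulative_prevalences l0)"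
  have pointwise: "l1_dist (int \<circ> partition_union h l) (int \<circ> p) \<le> ?hd u + ?ld v"
    if "h \<in> set_pmf (H u)" "l \<in> set_pmf (L v)" for u v h l
  proof -
    have h: "is_arg_min (\<lambda>q. l1_dist u (int \<circ> q)) (\<lambda>q. q \<in> partitions_upto n) h"
      and l: "is_arg_min (\<lambda>q. l1_dist v (int \<circ> cumulative_prevalences q)) (\<lambda>q. q \<in> partitions_upto n) l"
      using that H L by (auto simp: high_minimizers_def low_minimizers_def)
    then have "integer_partition h" "integer_partition l"
      by (auto simp: is_arg_min_def partitions_uptoD)
    then have "l1_dist (int \<circ> partition_union h l) (int \<circ> p)
        \<le> l1_dist (int \<circ> h) (int \<circ> h0)
          + l1_dist (int \<circ> cumulative_prevalences l) (int \<circ> cumulative_prevalences l0)"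
      using partitions_uptoD(1)[OF h0] partitions_uptoD(1)[OF l0] p
        cumulative_prevalences_split[OF p, of _ m]
      by (intro l1_dist_union_le) (auto simp: h0_def l0_def)
    also have "\<dots> \<le> ?hd u + ?ld v"
      using minimizer_dist_le[where f = "\<lambda>q. int \<circ> q", OF h h0]
        minimizer_dist_le[where f = "\<lambda>q. int \<circ> cumulative_prevalences q", OF l l0] by (rule add_mono)
    finally show ?thesis .
  qed
  have "(\<integral>\<^sup>+q. l1_dist (int \<circ> q) (int \<circ> p) \<partial>dp_anon_hist H L \<epsilon> n p)
      = (\<integral>\<^sup>+u. \<integral>\<^sup>+v. \<integral>\<^sup>+h. \<integral>\<^sup>+l. l1_dist (int \<circ> partition_union h l) (int \<circ> p)
          \<partial>L v \<partial>H u \<partial>noised \<epsilon> m (cumulative_prevalences l0) \<partial>noised \<epsilon> m h0)"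
    by (simp add: dp_anon_hist_eq trunc[unfolded l0_def] h0_def l0_def flip: m_def)
  \<comment> \<open>The pointwise bound depends on \<open>u\<close> and \<open>v\<close> alone, so
    the inner integrals over the tie-breaking disappear, whatever \<open>H\<close> and
    \<open>L\<close> choose among the minimizers.\<close>
  also have "\<dots> \<le> (\<integral>\<^sup>+u. \<integral>\<^sup>+v. ?hd u + ?ld v
          \<partial>noised \<epsilon> m (cumulative_prevalences l0) \<partial>noised \<epsilon> m h0)"
    by (intro nn_integral_mono nn_integral_pmf_le_const pointwise)
  also have "\<dots> = 2 * (\<integral>\<^sup>+u. l1_dist u (int \<circ> h0) \<partial>noised \<epsilon> m h0)
      + 2 * (\<integral>\<^sup>+v. l1_dist v (int \<circ> cumulative_prevalences l0)
              \<partial>noised \<epsilon> m (cumulative_prevalences l0))"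
    by (simp add: nn_integral_add nn_integral_cmult)
  also have "\<dots> \<le> 2 * ennreal (real m * (4 * exp (- \<epsilon>))) + 2 * ennreal (real m * (4 * exp (- \<epsilon>)))"
    using assms(1) by (intro add_mono mult_left_mono expectation_l1_dist_noised_le) auto
  \<comment> \<open>16 is two vectors, times 2 for each projection, times 4 for the mean of one
    noise entry; replacing \<open>m\<close> by \<open>2 * sqrt (real n)\<close> makes it 32.\<close>
  also have "\<dots> = ennreal (16 * exp (- \<epsilon>) * real m)"
    by (simp flip: ennreal_plus ennreal_numeral ennreal_mult)
  also have "\<dots> \<le> ennreal (16 * exp (- \<epsilon>) * (2 * sqrt (real n)))"
    using m by (intro ennreal_leI mult_left_mono) auto
  also have "16 * exp (- \<epsilon>) * (2 * sqrt (real n)) = 32 * sqrt (real n) / exp \<epsilon>"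
    by (simp add: exp_minus field_simps)
  finally show ?thesis .
qed

theorem theorem1:
  shows "\<exists>C::real. C > 0 \<and>
    (\<forall>(\<epsilon>::real) (n::nat) H L.
       \<epsilon> \<ge> 1 \<longrightarrow> n \<ge> 1 \<longrightarrow>
       (\<forall>v. set_pmf (H v) \<subseteq> high_minimizers n v) \<longrightarrow>
       (\<forall>v. set_pmf (L v) \<subseteq> low_minimizers n v) \<longrightarrow>
       differentially_private \<epsilon> 0 (partitions_upto n) (dp_anon_hist H L \<epsilon> n) \<and>
       error_upto n (dp_anon_hist H L \<epsilon> n) \<le> ennreal (C * sqrt (real n) / exp \<epsilon>))"
proof (intro exI[of _ 32] conjI allI impI)
  fix \<epsilon> :: real and n :: nat
    and H L :: "(nat \<Rightarrow> int) \<Rightarrow> (nat \<Rightarrow> nat) pmf"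
  assume *: "\<epsilon> \<ge> 1" "n \<ge> 1" "\<forall>v. set_pmf (H v) \<subseteq> high_minimizers n v"
    "\<forall>v. set_pmf (L v) \<subseteq> low_minimizers n v"
  show "differentially_private \<epsilon> 0 (partitions_upto n) (dp_anon_hist H L \<epsilon> n)"
    using *(1) by (intro dp_anon_hist_private) simp
  show "error_upto n (dp_anon_hist H L \<epsilon> n) \<le> ennreal (32 * sqrt (real n) / exp \<epsilon>)"
    unfolding error_upto_def using * by (intro SUP_least dp_anon_hist_error) auto
qed simp

end
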